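(* Let $\{Z_n\}_{n\ge 0}$ be a branching process in an i.i.d. random environment, with $X=\ln m_0$, $\mu=\mathbb{E}X$, $\sigma^2=\mathbb{E}(X-\mu)^2$ as in the context, such that almost surely every individual has at least one child and $0<\sigma^2<\infty$. Assume that there exists a constant $H>0$ such that $$\mathbb{E}(X-\mu)^k\le\tfrac12\,k!\,H^{k-2}\,\mathbb{E}(X-\mu)^2\qquad\text{for all integers }k\ge3.$$ Let $n_0\ge0$ and $n\ge1$ be integers, let $\delta_n\in(0,1)$ and $$\Delta_n=\frac{6(1+H)}{n}\ln(2/\delta_n)+\sqrt{\frac{36(1+H)^2}{n^2}\ln^2(2/\delta_n)+\frac2n\sigma^2\ln(2/\delta_n)}.$$ Then $[1,A_n]$, with $$A_n=Z_{n_0}\exp\{n(\mu+\Delta_n)\},$$ is a $1-\delta_n$ confidence interval for $Z_{n_0+n}$, i.e. $\mathbb{P}(1\le Z_{n_0+n}\le A_n)\ge1-\delta_n$.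
   Context: Branching process in a random environment: $\xi=(\xi_0,\xi_1,\dots)$ is a sequence of i.i.d. random variables (the environment). Each value of $\xi_n$ determines a probability distribution $p(\xi_n)=\{p_n(i): i\in\mathbb{N}\}$ on $\mathbb{N}=\{0,1,2,\dots\}$ (the offspring law at generation $n$). The process is defined by $Z_0=1$ and $Z_{n+1}=\sum_{i=1}^{Z_n}N_{n,i}$ for $n\ge 0$, where, conditionally on $\xi$, the variables $\{N_{n,i}: n\ge0,i\ge1\}$ are independent and, for each $n$, the $N_{n,i}$ $(i\ge1)$ have common law $p(\xi_n)$. $\mathbb{P}$ is the total (annealed) law, i.e. $\mathbb{P}(dx,d\xi)=\mathbb{P}_\xi(dx)\tau(d\xi)$ with $\mathbb{P}_\xi$ the conditional law given $\xi$ and $\tau$ the law of $\xi$; $\mathbb{E}$ is the corresponding expectation. Put $m_n=\sum_{i\ge0} i\,p_n(i)$ (conditional mean offspring number at generation $n$ given $\xi$), $X=\ln m_0$, $\mu=\mathbb{E}X$, $\sigma^2=\mathbb{E}(X-\mu)^2$, $\sigma>0$. Standing assumption: $p_0(0)=0$ almost surely (the probability of having no children is zero) and $0<\sigma^2<\infty$; hence $Z_n\ge1$ a.s. for all $n$. *)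

theory Defs
  imports "HOL-Probability.Probability"
begin

definition env_algebra ::
    "'w measure \<Rightarrow> 'e measure \<Rightarrow> (nat \<Rightarrow> 'w \<Rightarrow> 'e) \<Rightarrow> 'w measure" where
  "env_algebra M E \<xi> =
     vimage_algebra (space M) (\<lambda>w n. \<xi> n w) (\<Pi>\<^sub>M n\<in>UNIV. E)"

definition env_cond_prob ::
    "'w measure \<Rightarrow> 'e measure \<Rightarrow> (nat \<Rightarrow> 'w \<Rightarrow> 'e) \<Rightarrow> 'w set \<Rightarrow> 'w \<Rightarrow> real" where
  "env_cond_prob M E \<xi> A = real_cond_exp M (env_algebra M E \<xi>) (indicat_real A)"

text \<open>
  The probability space carries the annealed law; the quenched law enters through
  conditional probabilities given the \<open>\<sigma>\<close>-algebra generated by the whole environment.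
  The individuals of a generation are numbered from 1, so \<open>N n 0\<close> plays no role.
\<close>

locale branching_process_random_env = prob_space M
  for M :: "'w measure" +
  fixes E :: "'e measure"
    and \<xi> :: "nat \<Rightarrow> 'w \<Rightarrow> 'e"
    and p :: "'e \<Rightarrow> nat pmf"
    and N :: "nat \<Rightarrow> nat \<Rightarrow> 'w \<Rightarrow> nat"
  assumes env_indep: "indep_vars (\<lambda>_. E) \<xi> UNIV"
    and env_ident: "\<And>n. distr M E (\<xi> n) = distr M E (\<xi> 0)"
    and offspring_law_measurable: "\<And>k. (\<lambda>e. pmf (p e) k) \<in> borel_measurable E"
    and offspring_measurable:
      "\<And>n i. i \<ge> 1 \<Longrightarrow> N n i \<in> measurable M (count_space UNIV)"
    and offspring_cond_law:
      "\<And>n i A. i \<ge> 1 \<Longrightarrow>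
         AE w in M. env_cond_prob M E \<xi> {v \<in> space M. N n i v \<in> A} w
                      = measure (measure_pmf (p (\<xi> n w))) A"
    and offspring_cond_indep:
      "\<And>J A. finite J \<Longrightarrow> J \<subseteq> {(n, i). i \<ge> 1} \<Longrightarrow>
         AE w in M. env_cond_prob M E \<xi> {v \<in> space M. \<forall>(n, i)\<in>J. N n i v \<in> A n i} w
                      = (\<Prod>(n, i)\<in>J. env_cond_prob M E \<xi> {v \<in> space M. N n i v \<in> A n i} w)"

primrec generation_size :: "(nat \<Rightarrow> nat \<Rightarrow> 'w \<Rightarrow> nat) \<Rightarrow> nat \<Rightarrow> 'w \<Rightarrow> nat" where
  "generation_size N 0 w = 1"
| "generation_size N (Suc n) w = (\<Sum>i\<in>{1..generation_size N n w}. N n i w)"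

text \<open>The series below is meaningful only if it is summable; \<open>suminf\<close> is arbitrary otherwise.\<close>

definition offspring_mean ::
    "('e \<Rightarrow> nat pmf) \<Rightarrow> (nat \<Rightarrow> 'w \<Rightarrow> 'e) \<Rightarrow> nat \<Rightarrow> 'w \<Rightarrow> real" where
  "offspring_mean p \<xi> n w = (\<Sum>i. real i * pmf (p (\<xi> n w)) i)"

end

theory Submission
  imports Defs
begin

text \<open>
  Put \<open>L = ln (2 / \<delta>)\<close> and let \<open>\<Pi>\<close> be the product of the offspring means of the generations
  \<open>n\<^sub>0, \<dots>, n\<^sub>0 + n - 1\<close>. Conditioning successively on the environment and the past shows that
  \<open>Z\<^sub>n\<^sub>0\<^sub>+\<^sub>n / (Z\<^sub>n\<^sub>0 \<Pi>)\<close> has expectation at most 1, so by Markov's inequality it exceeds \<open>exp L\<close>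
  with probability at most \<open>\<delta> / 2\<close>. Moreover \<open>ln \<Pi>\<close> is a sum of \<open>n\<close> independent copies of \<open>X\<close>, and
  by Bernstein's inequality it exceeds \<open>n (\<mu> + \<Delta>) - L\<close> with probability at most \<open>\<delta> / 2\<close>: the
  constant in \<open>\<Delta>\<close> is large enough to absorb the loss of \<open>L\<close>. Outside these two events
  \<open>Z\<^sub>n\<^sub>0\<^sub>+\<^sub>n \<le> Z\<^sub>n\<^sub>0 exp (n (\<mu> + \<Delta>))\<close>.
\<close>

section \<open>Exponential moments and Bernstein's inequality\<close>

text \<open>For negative \<open>x\<close> the Lagrange remainder after an even-degree Taylor
  polynomial carries an odd power of \<open>x\<close> and is nonpositive, so the polynomial is at
  least \<open>exp x\<close>.\<close>

lemma even_Taylor_exp_nonneg: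
  fixes x :: real
  shows "0 \<le> (\<Sum>k<Suc (2 * m). x ^ k / fact k)"
proof (cases "x \<ge> 0")
  case True
  then show ?thesis by (intro sum_nonneg) auto
next
  case False
  obtain t where t: "exp x = (\<Sum>k<Suc (2 * m). x ^ k / fact k)
      + exp t / fact (Suc (2 * m)) * x ^ Suc (2 * m)"
    using Maclaurin_exp_le[of x "Suc (2 * m)"] by blast
  have "x ^ Suc (2 * m) \<le> 0"
    using False by (simp add: power_mult mult_nonpos_nonneg)
  then have "exp t / fact (Suc (2 * m)) * x ^ Suc (2 * m) \<le> 0"
    by (intro mult_nonneg_nonpos) auto
  with t show ?thesis
    using exp_gt_zero[of x] by linarith
qed

lemma ennreal_mult_inverse_le_1: "x * inverse x \<le> (1 :: ennreal)"
  by (cases "x = 0 \<or> x = \<top>")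
     (auto simp: ennreal_divide_self less_top simp flip: divide_ennreal_def)

context prob_space
begin

text \<open>Odd moments are only bounded from above, so dominated convergence is not available; the
  Taylor polynomials of even degree are nonnegative, which makes Fatou's lemma applicable.\<close>

lemma bernstein_mgf_bound:
  fixes Y :: "'a \<Rightarrow> real"
  assumes int: "\<And>k. integrable M (\<lambda>w. Y w ^ k)"
    and mean: "expectation Y = 0"
    and v: "v = expectation (\<lambda>w. (Y w)\<^sup>2)"
    and moments: "\<And>k. k \<ge> 3 \<Longrightarrow> expectation (\<lambda>w. Y w ^ k) \<le> 1/2 * fact k * H ^ (k - 2) * v"
    and H: "H > 0" and l: "0 \<le> l" "l * H < 1"
  shows "(\<integral>\<^sup>+w. ennreal (exp (l * Y w)) \<partial>M) \<le> ennreal (exp (l\<^sup>2 * v / (2 * (1 - l * H))))"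
proof -
  define T where "T m w = (\<Sum>k<Suc (2 * m). (l * Y w) ^ k / fact k)" for m w
  define c where "c = l\<^sup>2 * v / (2 * (1 - l * H))"
  have v0: "v \<ge> 0" unfolding v by simp
  have [measurable]: "Y \<in> borel_measurable M"
    using int[of 1] by (simp add: borel_measurable_integrable)
  have intT: "integrable M (T m)" for m
    unfolding T_def power_mult_distrib using int by (intro Bochner_Integration.integrable_sum) auto
  \<comment> \<open>One majorant for all orders: total mass 1 for \<open>k = 0\<close>, centring for
    \<open>k = 1\<close>, and from \<open>k = 2\<close> on a geometric sequence of ratio
    \<open>l * H\<close>, since the \<open>fact k\<close> of the moment hypothesis cancels.\<close>
  have moment: "expectation (\<lambda>w. (l * Y w) ^ k / fact k) \<le>
      (if k = 0 then 1 else if k = 1 then 0 else l\<^sup>2 * v / 2 * (l * H) ^ (k - 2))" for k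
  proof -
    have E: "expectation (\<lambda>w. (l * Y w) ^ k / fact k) = l ^ k / fact k * expectation (\<lambda>w. Y w ^ k)"
      by (simp add: power_mult_distrib)
    consider "k = 0" | "k = 1" | "k = 2" | "k \<ge> 3" by linarith
    then show ?thesis
    proof cases
      case 4
      have "l ^ k / fact k * expectation (\<lambda>w. Y w ^ k)
          \<le> l ^ k / fact k * (1/2 * fact k * H ^ (k - 2) * v)"
        using moments[OF 4] l by (intro mult_left_mono) auto
      also have "\<dots> = l\<^sup>2 * v / 2 * (l * H) ^ (k - 2)"
      proof -
        have "l ^ k = l ^ (2 + (k - 2))" by (subst le_add_diff_inverse) (use 4 in auto)
        then have "l ^ k = l\<^sup>2 * l ^ (k - 2)" by (simp only: power_add)
        then show ?thesis by (simp add: power_mult_distrib)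
      qed
      finally show ?thesis using E 4 by auto
    qed (use mean v in \<open>auto simp: E prob_space power_mult_distrib\<close>)
  qed
  have ET: "expectation (T m) \<le> exp c" for m
  proof (cases m)
    \<comment> \<open>Degree 0 is treated apart, because the general case peels off the two terms
      \<open>k = 0\<close> and \<open>k = 1\<close>.\<close>
    case 0
    have "T 0 = (\<lambda>w. 1)" unfolding T_def by (rule ext) simp
    with 0 show ?thesis using v0 l by (simp add: c_def prob_space)
  next
    case (Suc j)
    have "expectation (T m) = (\<Sum>k<Suc (2 * m). expectation (\<lambda>w. (l * Y w) ^ k / fact k))"
      unfolding T_def power_mult_distrib
      using int by (intro Bochner_Integration.integral_sum) auto
    also have "\<dots> \<le> (\<Sum>k<Suc (2 * m).
        if k = 0 then 1 else if k = 1 then 0 else l\<^sup>2 * v / 2 * (l * H) ^ (k - 2))"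
      by (intro sum_mono moment)
    also have "\<dots> = 1 + l\<^sup>2 * v / 2 * (\<Sum>k<Suc (2 * j). (l * H) ^ k)"
      proof -
      have split: "(\<Sum>k<Suc (Suc n). g k) = g 0 + g 1 + (\<Sum>k<n. g (Suc (Suc k)))"
        for g :: "nat \<Rightarrow> real" and n
        by (simp only: sum.lessThan_Suc_shift) simp
      have "Suc (2 * m) = Suc (Suc (Suc (2 * j)))" using Suc by simp
      then show ?thesis
        by (simp only: split) (simp add: sum_distrib_left del: sum.lessThan_Suc)
    qed
    also have "(\<Sum>k<Suc (2 * j). (l * H) ^ k) \<le> 1 / (1 - l * H)"
      using l H by (simp add: sum_gp_strict divide_right_mono del: sum.lessThan_Suc)
    then have "1 + l\<^sup>2 * v / 2 * (\<Sum>k<Suc (2 * j). (l * H) ^ k) \<le> 1 + l\<^sup>2 * v / 2 * (1 / (1 - l * H))"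
      using v0 by (intro add_left_mono mult_left_mono) auto
    also have "\<dots> = 1 + c" unfolding c_def by simp
    also have "\<dots> \<le> exp c" by simp
    finally show ?thesis .
  qed
  have lim: "(\<lambda>m. ennreal (T m w)) \<longlonglongrightarrow> ennreal (exp (l * Y w))" for w
  proof -
    have "(\<lambda>n. \<Sum>k<n. (l * Y w) ^ k / fact k) \<longlonglongrightarrow> exp (l * Y w)"
      using exp_converges[of "l * Y w"] by (simp add: sums_def divide_inverse mult.commute)
    moreover have "filterlim (\<lambda>m. Suc (2 * m)) at_top sequentially"
      by (rule filterlim_subseq) (simp add: strict_mono_def)
    ultimately show ?thesis
      unfolding T_def by (intro tendsto_ennrealI) (rule filterlim_compose)
  qed
  have "(\<integral>\<^sup>+w. ennreal (exp (l * Y w)) \<partial>M) = (\<integral>\<^sup>+w. liminf (\<lambda>m. ennreal (T m w)) \<partial>M)"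
    by (simp add: lim_imp_Liminf[OF sequentially_bot lim])
  also have "\<dots> \<le> liminf (\<lambda>m. \<integral>\<^sup>+w. ennreal (T m w) \<partial>M)"
    unfolding T_def by (intro nn_integral_liminf) measurable
  also have "\<dots> = liminf (\<lambda>m. ennreal (expectation (T m)))"
    using intT even_Taylor_exp_nonneg unfolding T_def
    by (subst nn_integral_eq_integral) (auto simp del: sum.lessThan_Suc)
  also have "\<dots> \<le> ennreal (exp c)"
    by (rule Liminf_le) (use ET in \<open>auto intro!: always_eventually ennreal_leI\<close>)
  finally show ?thesis unfolding c_def .
qed

text \<open>Chernoff's method: independence turns the exponential moment of the sum into a product.
  A uniform bound on the factors is assumed in place of moment conditions on each summand; it is
  later transferred from time 0 by stationarity.\<close>

lemma bernstein_tail_bound: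
  fixes Y :: "'i \<Rightarrow> 'a \<Rightarrow> real"
  assumes I: "finite I" "I \<noteq> {}"
    and indep: "indep_vars (\<lambda>_. borel) Y I"
    and mgf: "\<And>i l. i \<in> I \<Longrightarrow> 0 \<le> l \<Longrightarrow> l * H < 1 \<Longrightarrow>
      (\<integral>\<^sup>+w. ennreal (exp (l * Y i w)) \<partial>M) \<le> ennreal (exp (l\<^sup>2 * v / (2 * (1 - l * H))))"
    and H: "H > 0" and v: "v > 0" and t: "t > 0"
  shows "prob {w \<in> space M. (\<Sum>i\<in>I. Y i w) \<ge> t} \<le> exp (- (t\<^sup>2 / (2 * (real (card I) * v + H * t))))"
proof -
  define D where "D = real (card I) * v + H * t"
  \<comment> \<open>With this parameter \<open>1 - l * H\<close> becomes
    \<open>real (card I) * v / D\<close>, which is positive, and the exponent collapses to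
    \<open>- (t\<^sup>2 / (2 * D))\<close>.\<close>
  define l where "l = t / D"
  have n: "real (card I) > 0" using I by (simp add: card_gt_0_iff)
  have D: "D > 0" using n v H t by (simp add: D_def add_pos_pos)
  have l: "l > 0" using D t by (simp add: l_def)
  have lH: "1 - l * H = real (card I) * v / D"
    using D by (simp add: l_def D_def field_simps)
  then have lH1: "l * H < 1" using n v D by (metis diff_gt_0_iff_gt divide_pos_pos mult_pos_pos)
  have [measurable]: "Y i \<in> borel_measurable M" if "i \<in> I" for i
    using indep that by (auto simp: indep_vars_def)
  have "emeasure M {w \<in> space M. (\<Sum>i\<in>I. Y i w) \<ge> t}
      \<le> ennreal (exp (- l * t)) * (\<integral>\<^sup>+w. ennreal (exp (l * (\<Sum>i\<in>I. Y i w))) * indicator (space M) w \<partial>M)"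
    using Chernoff_ineq_nn_integral_ge[OF l sets.top, where a = t and f = "\<lambda>w. \<Sum>i\<in>I. Y i w"] by simp
  also have "(\<integral>\<^sup>+w. ennreal (exp (l * (\<Sum>i\<in>I. Y i w))) * indicator (space M) w \<partial>M)
      = (\<integral>\<^sup>+w. (\<Prod>i\<in>I. ennreal (exp (l * Y i w))) \<partial>M)"
    using I by (intro nn_integral_cong) (simp add: sum_distrib_left exp_sum prod_ennreal)
  also have "\<dots> = (\<Prod>i\<in>I. \<integral>\<^sup>+w. ennreal (exp (l * Y i w)) \<partial>M)"
    using I indep by (intro indep_vars_nn_integral) (auto intro: indep_vars_compose2)
  also have "\<dots> \<le> (\<Prod>i\<in>I. ennreal (exp (l\<^sup>2 * v / (2 * (1 - l * H)))))"
    using mgf l lH1 by (intro prod_mono_ennreal) auto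
  also have "\<dots> = ennreal (exp (real (card I) * (l\<^sup>2 * v / (2 * (1 - l * H)))))"
    unfolding exp_of_nat_mult prod_constant by (simp add: ennreal_power)
  finally have "emeasure M {w \<in> space M. (\<Sum>i\<in>I. Y i w) \<ge> t}
      \<le> ennreal (exp (- l * t)) * ennreal (exp (real (card I) * (l\<^sup>2 * v / (2 * (1 - l * H)))))"
    by (simp add: mult_left_mono)
  also have "\<dots> = ennreal (exp (- l * t + real (card I) * (l\<^sup>2 * v / (2 * (1 - l * H)))))"
    by (simp only: exp_add ennreal_mult exp_ge_zero)
  also have "- l * t + real (card I) * (l\<^sup>2 * v / (2 * (1 - l * H))) = - (t\<^sup>2 / (2 * D))"
    using n v D unfolding lH by (simp add: l_def field_simps power2_eq_square)
  finally show ?thesis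
    unfolding D_def by (simp add: emeasure_eq_measure)
qed

end

section \<open>The history: environment and earlier offspring numbers\<close>

context branching_process_random_env
begin

text \<open>Extended counterpart of \<open>offspring_mean\<close>: it keeps its meaning where the
  series diverges, so the integral identities below hold for every environment.\<close>

definition env_mean :: "nat \<Rightarrow> 'w \<Rightarrow> ennreal" where
  "env_mean k w = (\<Sum>c. ennreal (real c * pmf (p (\<xi> k w)) c))"

definition cylinder :: "(nat \<times> nat) set \<Rightarrow> (nat \<Rightarrow> nat \<Rightarrow> nat set) \<Rightarrow> 'w set" where
  "cylinder J C = {v \<in> space M. \<forall>(j, i)\<in>J. N j i v \<in> C j i}"

text \<open>The generators are chosen so that quenched independence applies to each of them
  directly, while they remain closed under intersection, as the uniqueness theorem for measures
  demands.\<close>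

definition history_gen :: "nat \<Rightarrow> 'w set set" where
  "history_gen k = {B \<inter> cylinder J C | B J C.
     B \<in> sets (env_algebra M E \<xi>) \<and> finite J \<and> J \<subseteq> {..<k} \<times> {1..}}"

text \<open>The environment enters with its future, only the offspring numbers are cut off at time \<open>k\<close>.\<close>

definition history :: "nat \<Rightarrow> 'w measure" where
  "history k = sigma (space M) (history_gen k)"

lemma env_measurable [measurable]: "\<xi> n \<in> measurable M E"
  using env_indep by (auto simp: indep_vars_def)

lemma env_sequence_measurable: "(\<lambda>w n. \<xi> n w) \<in> measurable M (\<Pi>\<^sub>M n\<in>UNIV. E)"
  by (intro measurable_PiM_single') (auto simp: measurable_space[OF env_measurable])

lemma space_env_algebra [simp]: "space (env_algebra M E \<xi>) = space M"
  by (simp add: env_algebra_def)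

lemma subalgebra_env: "subalgebra M (env_algebra M E \<xi>)"
  unfolding subalgebra_def env_algebra_def
  using sets_image_in_sets[OF refl env_sequence_measurable] by simp

sublocale env: finite_measure_subalgebra M "env_algebra M E \<xi>"
  using subalgebra_env by unfold_locales

lemma env_measurable_env_algebra: "\<xi> n \<in> measurable (env_algebra M E \<xi>) E"
proof -
  have "(\<lambda>w n. \<xi> n w) \<in> measurable (env_algebra M E \<xi>) (\<Pi>\<^sub>M n\<in>UNIV. E)"
    unfolding env_algebra_def
    using measurable_space[OF env_sequence_measurable] by (intro measurable_vimage_algebra1) auto
  from measurable_compose[OF this measurable_component_singleton[of n]] show ?thesis by simp
qed

lemma cylinder_in_sets:
  assumes "finite J" "J \<subseteq> UNIV \<times> {1..}"
  shows "cylinder J C \<in> events"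
proof -
  have "{v \<in> space M. \<forall>x\<in>J. N (fst x) (snd x) v \<in> C (fst x) (snd x)} \<in> events"
  proof (rule sets.sets_Collect_finite_All[OF _ assms(1)])
    fix x assume "x \<in> J"
    then have [measurable]: "N (fst x) (snd x) \<in> measurable M (count_space UNIV)"
      using assms(2) by (intro offspring_measurable) auto
    show "{v \<in> space M. N (fst x) (snd x) v \<in> C (fst x) (snd x)} \<in> events"
      by measurable
  qed
  then show ?thesis by (simp add: cylinder_def case_prod_beta)
qed

lemma history_gen_subset: "history_gen k \<subseteq> events"
  using subalgebra_env by (auto simp: history_gen_def subalgebra_def intro!: sets.Int cylinder_in_sets)

lemma history_gen_Pow: "history_gen k \<subseteq> Pow (space M)"
  using history_gen_subset[of k] sets.sets_into_space by blast

lemma space_history [simp]: "space (history k) = space M"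
  by (simp add: history_def space_measure_of_conv)

lemma sets_history: "sets (history k) = sigma_sets (space M) (history_gen k)"
  using history_gen_Pow by (simp add: history_def)

lemma subalgebra_history: "subalgebra M (history k)"
  unfolding subalgebra_def sets_history using sets.sigma_sets_subset[OF history_gen_subset] by simp

lemma env_algebra_subset_history: "sets (env_algebra M E \<xi>) \<subseteq> sets (history k)"
proof
  fix B assume B: "B \<in> sets (env_algebra M E \<xi>)"
  then have "B = B \<inter> cylinder {} (\<lambda>_ _. {})"
    using sets.sets_into_space[OF B] by (auto simp: cylinder_def)
  with B have "B \<in> history_gen k" unfolding history_gen_def by blast
  then show "B \<in> sets (history k)" unfolding sets_history by auto
qed

lemma env_measurable_history [measurable]: "\<xi> n \<in> measurable (history k) E"
  using env_measurable_env_algebra env_algebra_subset_history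
  by (intro measurable_from_subalg[of "history k" "env_algebra M E \<xi>"]) (auto simp: subalgebra_def)

lemma offspring_measurable_history:
  assumes "j < k" "i \<ge> 1"
  shows "N j i \<in> measurable (history k) (count_space UNIV)"
proof (rule measurableI)
  fix A :: "nat set"
  have "N j i -` A \<inter> space M = space M \<inter> cylinder {(j, i)} (\<lambda>_ _. A)"
    by (auto simp: cylinder_def)
  moreover have "space M \<in> sets (env_algebra M E \<xi>)"
    using sets.top[of "env_algebra M E \<xi>"] by simp
  ultimately have "N j i -` A \<inter> space M \<in> history_gen k"
    unfolding history_gen_def using assms by blast
  then show "N j i -` A \<inter> space (history k) \<in> sets (history k)"
    unfolding sets_history by auto
qed auto

text \<open>The upper limit of summation is random but has countably many values; for each frozen
  value \<open>z\<close> the sum is a finite sum of measurable offspring numbers, and the pieces are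
  glued.\<close>

lemma generation_size_measurable:
  assumes "l \<le> k"
  shows "generation_size N l \<in> measurable (history k) (count_space UNIV)"
  using assms
proof (induction l)
  case 0
  have "generation_size N 0 = (\<lambda>w. 1)" by (rule ext) simp
  then show ?case by simp
next
  case (Suc l)
  have "(\<lambda>w. \<Sum>i\<in>{1..z}. N l i w) \<in> measurable (history k) (count_space UNIV)" for z
  proof (induction z)
    case 0
    then show ?case by simp
  next
    case IH [measurable]: (Suc z)
    have [measurable]: "N l (Suc z) \<in> measurable (history k) (count_space UNIV)"
      using \<open>Suc l \<le> k\<close> by (intro offspring_measurable_history) auto
    have "(\<lambda>w. (\<Sum>i\<in>{1..z}. N l i w) + N l (Suc z) w) \<in> measurable (history k) (count_space UNIV)"
      by measurable
    then show ?case by simp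
  qed
  moreover have "generation_size N l \<in> measurable (history k) (count_space UNIV)"
    using Suc by simp
  ultimately have "(\<lambda>w. \<Sum>i\<in>{1..generation_size N l w}. N l i w) \<in> measurable (history k) (count_space UNIV)"
    by (rule measurable_compose_countable)
  moreover have "generation_size N (Suc l) = (\<lambda>w. \<Sum>i\<in>{1..generation_size N l w}. N l i w)"
    by (rule ext) simp
  ultimately show ?case by simp
qed

lemma Int_stable_history_gen: "Int_stable (history_gen k)"
proof (rule Int_stableI)
  fix S S' assume "S \<in> history_gen k" "S' \<in> history_gen k"
  then obtain B J C B' J' C' where
    S: "S = B \<inter> cylinder J C" "B \<in> sets (env_algebra M E \<xi>)" "finite J" "J \<subseteq> {..<k} \<times> {1..}"
    and S': "S' = B' \<inter> cylinder J' C'" "B' \<in> sets (env_algebra M E \<xi>)" "finite J'"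
      "J' \<subseteq> {..<k} \<times> {1..}"
    unfolding history_gen_def by blast
  \<comment> \<open>\<open>D\<close> imposes both constraints on the indices common to
    \<open>J\<close> and \<open>J'\<close>, and the relevant single one on the rest of their
    union.\<close>
  define D where "D j i = {x. ((j, i) \<in> J \<longrightarrow> x \<in> C j i) \<and> ((j, i) \<in> J' \<longrightarrow> x \<in> C' j i)}" for j i
  have "cylinder J C \<inter> cylinder J' C' = cylinder (J \<union> J') D"
    unfolding cylinder_def D_def by blast
  then have "S \<inter> S' = (B \<inter> B') \<inter> cylinder (J \<union> J') D" using S S' by auto
  then show "S \<inter> S' \<in> history_gen k"
    unfolding history_gen_def using S S'
    by (intro CollectI exI[of _ "B \<inter> B'"] exI[of _ "J \<union> J'"] exI[of _ D]) auto
qed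

section \<open>Offspring law conditional on the history\<close>

lemma offspring_law_measurable_env_algebra [measurable]:
  "(\<lambda>w. pmf (p (\<xi> k w)) c) \<in> borel_measurable (env_algebra M E \<xi>)"
  by (rule measurable_compose[OF env_measurable_env_algebra offspring_law_measurable])

lemma offspring_law_measurable_M [measurable]:
  "(\<lambda>w. pmf (p (\<xi> k w)) c) \<in> borel_measurable M"
  by (rule measurable_from_subalg[OF subalgebra_env]) measurable

text \<open>Given the environment, \<open>N k i\<close> is independent of the earlier offspring
  numbers, so the conditional probability of the enlarged cylinder factors; integrating over the
  environment event \<open>B\<close> removes the conditioning.\<close>

lemma prob_generator_offspring:
  assumes B: "B \<in> sets (env_algebra M E \<xi>)"
    and J: "finite J" "J \<subseteq> {..<k} \<times> {1..}" and i: "i \<ge> 1"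
  shows "prob (B \<inter> cylinder J C \<inter> {w \<in> space M. N k i w = c})
    = (\<integral>w. indicator (B \<inter> cylinder J C) w * pmf (p (\<xi> k w)) c \<partial>M)"
proof -
  let ?G = "env_algebra M E \<xi>"
  \<comment> \<open>The cylinder is enlarged by the single constraint \<open>N k i = c\<close>. The
    index \<open>(k, i)\<close> is new because \<open>J\<close> contains only times below
    \<open>k\<close>.\<close>
  define C' where "C' = (\<lambda>j l. if (j, l) = (k, i) then {c} else C j l)"
  let ?J = "insert (k, i) J"
  have new: "(k, i) \<notin> J" using J by auto
  have J': "?J \<subseteq> {(n, i). i \<ge> 1}" "J \<subseteq> {(n, i). i \<ge> 1}" using J i by auto
  have C'J: "(\<Prod>(n, i)\<in>J. env_cond_prob M E \<xi> {v \<in> space M. N n i v \<in> C' n i} w)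
      = (\<Prod>(n, i)\<in>J. env_cond_prob M E \<xi> {v \<in> space M. N n i v \<in> C n i} w)" for w
    using new by (intro prod.cong) (auto simp: C'_def)
  have [measurable]: "cylinder ?J C' \<in> events" "cylinder J C \<in> events"
    using J i by (auto intro!: cylinder_in_sets)
  have [measurable]: "B \<in> events" "B \<in> sets ?G" using B subalgebra_env by (auto simp: subalgebra_def)
  have cp: "AE w in M. real_cond_exp M ?G (indicat_real (cylinder ?J C')) w
      = pmf (p (\<xi> k w)) c * real_cond_exp M ?G (indicat_real (cylinder J C)) w"
    using offspring_cond_indep[OF finite.insertI[OF J(1)] J'(1), of C']
      offspring_cond_indep[OF J(1) J'(2), of C] offspring_cond_law[OF i, of k "{c}"]
  proof eventually_elim
    case (elim w)
    then show ?case
      using new C'J J(1)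
      by (simp add: cylinder_def env_cond_prob_def C'_def measure_pmf_single)
  qed
  have "B \<inter> cylinder J C \<inter> {w \<in> space M. N k i w = c} = B \<inter> cylinder ?J C'"
    using new by (auto simp: cylinder_def C'_def split: if_splits)
  then have "prob (B \<inter> cylinder J C \<inter> {w \<in> space M. N k i w = c})
      = (\<integral>w. indicator B w * indicator (cylinder ?J C') w \<partial>M)"
    by (simp flip: indicator_inter_arith)
  \<comment> \<open>Conditioning can be inserted because \<open>indicator B\<close> is
    environment-measurable. After the factorisation it is removed in the same way, with the
    offspring probability now part of the environment-measurable weight.\<close>
  also have "\<dots> = (\<integral>w. indicator B w * real_cond_exp M ?G (indicat_real (cylinder ?J C')) w \<partial>M)"
    by (rule env.real_cond_exp_intg(2)[symmetric])
       (auto simp flip: indicator_inter_arith simp: less_top[symmetric])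
  also have "\<dots> = (\<integral>w. (indicator B w * pmf (p (\<xi> k w)) c)
      * real_cond_exp M ?G (indicat_real (cylinder J C)) w \<partial>M)"
    using cp by (intro integral_cong_AE) auto
  also have "\<dots> = (\<integral>w. (indicator B w * pmf (p (\<xi> k w)) c) * indicator (cylinder J C) w \<partial>M)"
    by (intro env.real_cond_exp_intg(2) integrable_const_bound[where B = 1])
       (auto simp: indicator_def pmf_le_1)
  finally show ?thesis
    by (simp add: indicator_inter_arith mult_ac)
qed

text \<open>Both sides integrate \<open>f\<close> against a finite measure, and the two measures
  agree on the generators of the history, hence on all of it. In effect \<open>p (\<xi> k w)\<close>
  is the conditional law of \<open>N k i\<close> given the history.\<close>

lemma nn_integral_history_offspring_law:
  assumes f: "f \<in> borel_measurable (history k)" and i: "i \<ge> 1"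
  shows "(\<integral>\<^sup>+w. f w * indicator {w \<in> space M. N k i w = c} w \<partial>M)
    = (\<integral>\<^sup>+w. f w * ennreal (pmf (p (\<xi> k w)) c) \<partial>M)"
proof -
  let ?S = "{w \<in> space M. N k i w = c}"
  have [measurable]: "N k i \<in> measurable M (count_space UNIV)" using offspring_measurable[OF i] .
  have [measurable]: "f \<in> borel_measurable M" by (rule measurable_from_subalg[OF subalgebra_history f])
  define P where "P = density M (indicator ?S)"
  define Q where "Q = density M (\<lambda>w. ennreal (pmf (p (\<xi> k w)) c))"
  have sub: "subalgebra P (history k)" "subalgebra Q (history k)"
    using subalgebra_history by (auto simp: subalgebra_def P_def Q_def)
  have eq: "emeasure P S = emeasure Q S" if S: "S \<in> history_gen k" for S
  proof -
    obtain B J C where *: "S = B \<inter> cylinder J C" "B \<in> sets (env_algebra M E \<xi>)" "finite J"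
      "J \<subseteq> {..<k} \<times> {1..}" using S unfolding history_gen_def by blast
    have [measurable]: "S \<in> events" using S history_gen_subset by blast
    have "emeasure P S = emeasure M (S \<inter> ?S)"
      unfolding P_def by (subst emeasure_density)
        (auto simp: Int_commute simp flip: indicator_inter_arith intro!: nn_integral_indicator)
    also have "\<dots> = ennreal (\<integral>w. indicator S w * pmf (p (\<xi> k w)) c \<partial>M)"
      unfolding emeasure_eq_measure using prob_generator_offspring[OF *(2-4) i] *(1) by simp
    also have "\<dots> = (\<integral>\<^sup>+w. ennreal (indicator S w * pmf (p (\<xi> k w)) c) \<partial>M)"
      by (intro nn_integral_eq_integral[symmetric] integrable_const_bound[where B = 1])
         (auto simp: indicator_def pmf_le_1)
    also have "\<dots> = emeasure Q S"
      unfolding Q_def by (subst emeasure_density)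
        (auto simp: indicator_def intro!: nn_integral_cong)
    finally show ?thesis .
  qed
  have gen: "S \<in> sets (history k)" if "S \<in> history_gen k" for S
    using that unfolding sets_history by auto
  have top: "space M \<in> history_gen k"
  proof -
    have "space M = space M \<inter> cylinder {} (\<lambda>_ _. {})" by (simp add: cylinder_def)
    moreover have "space M \<in> sets (env_algebra M E \<xi>)"
      using sets.top[of "env_algebra M E \<xi>"] by simp
    ultimately show ?thesis unfolding history_gen_def by blast
  qed
  \<comment> \<open>The whole space is itself a generator, so finiteness of this one mass lets
    equality pass from the generators to the whole history.\<close>
  have "emeasure P (space M) \<noteq> \<infinity>"
    unfolding P_def by (subst emeasure_density) (auto simp flip: indicator_inter_arith)
  then have "restr_to_subalg P (history k) = restr_to_subalg Q (history k)"
    using sub eq gen top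
    by (intro measure_eqI_generator_eq[OF Int_stable_history_gen history_gen_Pow, where A = "\<lambda>_. space M"])
       (auto simp: emeasure_restr_to_subalg sets_restr_to_subalg sets_history)
  then have "(\<integral>\<^sup>+w. f w \<partial>P) = (\<integral>\<^sup>+w. f w \<partial>Q)"
    using nn_integral_subalgebra2[OF sub(1) f] nn_integral_subalgebra2[OF sub(2) f] by simp
  then show ?thesis
    unfolding P_def Q_def by (simp add: nn_integral_density mult.commute)
qed

section \<open>Conditional mean growth of the generations\<close>

lemma env_mean_measurable [measurable]: "env_mean n \<in> borel_measurable (history k)"
proof -
  have [measurable]: "(\<lambda>w. pmf (p (\<xi> n w)) c) \<in> borel_measurable (history k)" for c
    by (rule measurable_compose[OF env_measurable_history offspring_law_measurable])
  show ?thesis unfolding env_mean_def by measurable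
qed

text \<open>Splitting by the value \<open>c\<close> of \<open>N k i\<close> reduces this to the
  conditional law, summed with weight \<open>c\<close>; nonnegativity permits exchanging series and
  integral.\<close>

lemma nn_integral_history_offspring_mean:
  assumes f: "f \<in> borel_measurable (history k)" and i: "i \<ge> 1"
  shows "(\<integral>\<^sup>+w. f w * of_nat (N k i w) \<partial>M) = (\<integral>\<^sup>+w. f w * env_mean k w \<partial>M)"
proof -
  have [measurable]: "N k i \<in> measurable M (count_space UNIV)" using offspring_measurable[OF i] .
  have [measurable]: "f \<in> borel_measurable M" by (rule measurable_from_subalg[OF subalgebra_history f])
  let ?S = "\<lambda>c. {w \<in> space M. N k i w = c}"
  have N: "of_nat (N k i w) = (\<Sum>c. of_nat c * indicator (?S c) w :: ennreal)" if "w \<in> space M" for w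
    using that by (subst suminf_finite[of "{N k i w}"]) (auto simp: indicator_def)
  have "(\<integral>\<^sup>+w. f w * of_nat (N k i w) \<partial>M)
      = (\<integral>\<^sup>+w. (\<Sum>c. of_nat c * (f w * indicator (?S c) w)) \<partial>M)"
    by (intro nn_integral_cong) (simp only: N ennreal_suminf_cmult[symmetric] mult.left_commute)
  also have "\<dots> = (\<Sum>c. of_nat c * (\<integral>\<^sup>+w. f w * indicator (?S c) w \<partial>M))"
    by (simp add: nn_integral_suminf nn_integral_cmult)
  also have "\<dots> = (\<Sum>c. of_nat c * (\<integral>\<^sup>+w. f w * ennreal (pmf (p (\<xi> k w)) c) \<partial>M))"
    using nn_integral_history_offspring_law[OF f i] by simp
  also have "\<dots> = (\<integral>\<^sup>+w. (\<Sum>c. of_nat c * (f w * ennreal (pmf (p (\<xi> k w)) c))) \<partial>M)"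
    by (simp add: nn_integral_suminf nn_integral_cmult)
  also have "\<dots> = (\<integral>\<^sup>+w. f w * env_mean k w \<partial>M)"
    unfolding env_mean_def
    by (intro nn_integral_cong)
       (simp only: ennreal_mult of_nat_0_le_iff pmf_nonneg ennreal_suminf_cmult[symmetric]
          mult.left_commute flip: ennreal_of_nat_eq_real_of_nat)
  finally show ?thesis .
qed

text \<open>Whether an individual exists in generation \<open>k\<close> is decided by the history,
  so its indicator is absorbed into the test function, and each existing individual contributes the
  same conditional mean.\<close>

lemma nn_integral_next_generation:
  assumes f: "f \<in> borel_measurable (history k)"
  shows "(\<integral>\<^sup>+w. f w * of_nat (generation_size N (Suc k) w) \<partial>M)
    = (\<integral>\<^sup>+w. f w * of_nat (generation_size N k w) * env_mean k w \<partial>M)"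
proof -
  let ?Z = "generation_size N k"
  let ?I = "\<lambda>i w. if i < ?Z w then 1 else 0 :: ennreal"
  note [measurable] = f generation_size_measurable[OF order.refl]
  have [measurable]: "f \<in> borel_measurable M" "?Z \<in> measurable M (count_space UNIV)"
    "env_mean k \<in> borel_measurable M"
    by (auto intro!: measurable_from_subalg[OF subalgebra_history[of k]])
  have [measurable]: "N k (Suc i) \<in> measurable M (count_space UNIV)" for i
    by (intro offspring_measurable) simp
  have suminf: "(\<Sum>i. ?I i w * g i) = (\<Sum>i<?Z w. g i)" for g w
    by (subst suminf_finite[of "{..<?Z w}"]) auto
  \<comment> \<open>The series starts at 0 while individuals are numbered from 1: the indicator of
    \<open>i < ?Z w\<close> goes with individual \<open>Suc i\<close>.\<close>
  have Z': "of_nat (generation_size N (Suc k) w) = (\<Sum>i. ?I i w * of_nat (N k (Suc i) w))" for w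
  proof -
    have "generation_size N (Suc k) w = (\<Sum>i<?Z w. N k (Suc i) w)"
      using sum.shift_bounds_cl_Suc_ivl[of "\<lambda>i. N k i w" 0 "?Z w - 1"]
      by (simp add: sum.atLeast1_atMost_eq)
    then show ?thesis unfolding suminf by simp
  qed
  have Z: "of_nat (?Z w) = (\<Sum>i. ?I i w)" for w
    using suminf[of w "\<lambda>_. 1"] by simp
  have "(\<integral>\<^sup>+w. f w * of_nat (generation_size N (Suc k) w) \<partial>M)
      = (\<integral>\<^sup>+w. (\<Sum>i. f w * ?I i w * of_nat (N k (Suc i) w)) \<partial>M)"
    unfolding Z' by (simp add: mult.assoc)
  also have "\<dots> = (\<Sum>i. \<integral>\<^sup>+w. f w * ?I i w * of_nat (N k (Suc i) w) \<partial>M)"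
    by (intro nn_integral_suminf) measurable
  also have "\<dots> = (\<Sum>i. \<integral>\<^sup>+w. f w * ?I i w * env_mean k w \<partial>M)"
    by (intro suminf_cong nn_integral_history_offspring_mean) auto
  also have "\<dots> = (\<integral>\<^sup>+w. (\<Sum>i. f w * ?I i w * env_mean k w) \<partial>M)"
    by (intro nn_integral_suminf[symmetric]) measurable
  also have "\<dots> = (\<integral>\<^sup>+w. f w * of_nat (?Z w) * env_mean k w \<partial>M)"
    unfolding Z by simp
  finally show ?thesis .
qed

text \<open>Only an inequality, since \<open>x * inverse x = 0\<close> in \<^typ>\<open>ennreal\<close> when \<open>x = 0\<close> or \<open>x = \<top>\<close>.\<close>

lemma nn_integral_growth_ratio_le_1:
  "(\<integral>\<^sup>+w. inverse (of_nat (generation_size N a w)) * (\<Prod>j\<in>{a..<a + n}. inverse (env_mean j w))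
      * of_nat (generation_size N (a + n) w) \<partial>M) \<le> 1"
proof (induction n)
  case 0
  have "(\<integral>\<^sup>+w. inverse (of_nat (generation_size N a w)) * of_nat (generation_size N a w) \<partial>M)
      \<le> (\<integral>\<^sup>+w. 1 \<partial>M)"
    using ennreal_mult_inverse_le_1 by (intro nn_integral_mono) (simp add: mult.commute)
  then show ?case by (simp add: emeasure_space_1)
next
  case (Suc n)
  have [measurable]: "generation_size N a \<in> measurable (history (a + n)) (count_space UNIV)"
    by (rule generation_size_measurable) simp
  let ?Z = "\<lambda>k w. of_nat (generation_size N k w) :: ennreal"
  let ?m = "\<lambda>w. env_mean (a + n) w"
  let ?f = "\<lambda>n w. inverse (?Z a w) * (\<Prod>j\<in>{a..<a + n}. inverse (env_mean j w))"
  have f: "?f (Suc n) w = ?f n w * inverse (?m w)" for w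
    by (simp add: mult.assoc)
  \<comment> \<open>The factor \<open>inverse (env_mean (a + n) w)\<close> may belong to the test
    function because the history at time \<open>a + n\<close> already contains the whole
    environment.\<close>
  have "(\<integral>\<^sup>+w. ?f (Suc n) w * ?Z (Suc (a + n)) w \<partial>M)
      = (\<integral>\<^sup>+w. ?f (Suc n) w * ?Z (a + n) w * ?m w \<partial>M)"
    by (rule nn_integral_next_generation) measurable
  also have "\<dots> = (\<integral>\<^sup>+w. ?f n w * ?Z (a + n) w * (?m w * inverse (?m w)) \<partial>M)"
    unfolding f by (intro nn_integral_cong) (simp only: mult_ac)
  also have "\<dots> \<le> (\<integral>\<^sup>+w. ?f n w * ?Z (a + n) w * 1 \<partial>M)"
    by (intro nn_integral_mono mult_left_mono ennreal_mult_inverse_le_1) simp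
  also have "\<dots> \<le> 1" using Suc by simp
  finally show ?case by (simp only: add_Suc_right)
qed

section \<open>Almost sure properties by stationarity of the environment\<close>

lemma AE_env_shift:
  assumes "{e \<in> space E. P e} \<in> sets E" and "AE w in M. P (\<xi> 0 w)"
  shows "AE w in M. P (\<xi> n w)"
  using assms(2) unfolding AE_distr_iff[OF env_measurable assms(1), symmetric]
  by (subst env_ident)

lemma nn_integral_env_shift:
  assumes "f \<in> borel_measurable E"
  shows "(\<integral>\<^sup>+w. f (\<xi> n w) \<partial>M) = (\<integral>\<^sup>+w. f (\<xi> 0 w) \<partial>M)"
  using nn_integral_distr[OF env_measurable[of n], of f]
    nn_integral_distr[OF env_measurable[of 0], of f] assms env_ident[of n] by simp

text \<open>With constant test function, the conditional law gives the probability of no child as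
  the mean of \<open>pmf (p (\<xi> k w)) 0\<close>, which vanishes at time 0 and hence, by equality
  of laws, at time \<open>k\<close>.\<close>

lemma AE_offspring_pos:
  assumes "AE w in M. pmf (p (\<xi> 0 w)) 0 = 0" and i: "i \<ge> 1"
  shows "AE w in M. N k i w \<noteq> 0"
proof -
  note [measurable] = offspring_measurable[OF i] offspring_law_measurable
  have "AE w in M. pmf (p (\<xi> k w)) 0 = 0"
    by (rule AE_env_shift[where P = "\<lambda>e. pmf (p e) 0 = 0", OF _ assms(1)]) measurable
  then have "(\<integral>\<^sup>+w. 1 * ennreal (pmf (p (\<xi> k w)) 0) \<partial>M) = 0"
    by (subst nn_integral_0_iff_AE) auto
  then have "emeasure M {w \<in> space M. N k i w = 0} = 0"
    using nn_integral_history_offspring_law[of "\<lambda>_. 1" k i 0] i by simp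
  then show ?thesis by (subst AE_iff_measurable[OF _ refl]) auto
qed

lemma AE_generation_size_pos:
  assumes "AE w in M. pmf (p (\<xi> 0 w)) 0 = 0"
  shows "AE w in M. \<forall>k. generation_size N k w \<ge> 1"
proof -
  \<comment> \<open>It is enough to follow the first individual: every nonempty generation contains
    it, and its children make the next generation nonempty.\<close>
  have "AE w in M. \<forall>k. N k 1 w \<noteq> 0"
    using AE_offspring_pos[OF assms] by (simp add: AE_all_countable)
  then show ?thesis
  proof eventually_elim
    case (elim w)
    show ?case
    proof
      fix k show "generation_size N k w \<ge> 1"
      proof (induction k)
        case (Suc k)
        then have "N k 1 w \<le> (\<Sum>i\<in>{1..generation_size N k w}. N k i w)"
          by (intro member_le_sum) auto
        with elim show ?case by (simp add: Suc_le_eq) (metis One_nat_def gr0I le_zero_eq)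
      qed simp
    qed
  qed
qed

lemma env_mean_eq_offspring_mean:
  assumes "summable (\<lambda>i. real i * pmf (p (\<xi> k w)) i)"
  shows "env_mean k w = ennreal (offspring_mean p \<xi> k w)"
  unfolding env_mean_def offspring_mean_def using assms by (intro suminf_ennreal2) auto

lemma offspring_mean_pos:
  assumes "summable (\<lambda>i. real i * pmf (p (\<xi> k w)) i)" "pmf (p (\<xi> k w)) 0 = 0"
  shows "offspring_mean p \<xi> k w > 0"
proof -
  obtain i where i: "i \<in> set_pmf (p (\<xi> k w))" using set_pmf_not_empty[of "p (\<xi> k w)"] by blast
  then have "i \<noteq> 0" "pmf (p (\<xi> k w)) i > 0"
    using assms(2) by (metis set_pmf_iff) (simp add: pmf_positive i)
  then show ?thesis
    unfolding offspring_mean_def using assms(1) by (intro suminf_pos2[of _ i]) auto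
qed

lemma AE_regular_env:
  assumes "AE w in M. pmf (p (\<xi> 0 w)) 0 = 0"
    and "AE w in M. summable (\<lambda>i. real i * pmf (p (\<xi> 0 w)) i)"
  shows "AE w in M. \<forall>k. env_mean k w = ennreal (offspring_mean p \<xi> k w) \<and> offspring_mean p \<xi> k w > 0"
proof -
  note [measurable] = offspring_law_measurable
  \<comment> \<open>Finiteness of the extended series is equivalent to summability of these
    nonnegative terms, and its measurability in \<open>e\<close>, which the transfer to later times
    demands, is immediate.\<close>
  define P where "P e \<longleftrightarrow> pmf (p e) 0 = 0 \<and> (\<Sum>i. ennreal (real i * pmf (p e) i)) \<noteq> \<top>" for e
  have P: "P e \<longleftrightarrow> pmf (p e) 0 = 0 \<and> summable (\<lambda>i. real i * pmf (p e) i)" for e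
  proof -
    have "(\<Sum>i. ennreal (real i * pmf (p e) i)) \<noteq> \<top>" if "summable (\<lambda>i. real i * pmf (p e) i)"
    proof -
      have "(\<Sum>i. ennreal (real i * pmf (p e) i)) = ennreal (\<Sum>i. real i * pmf (p e) i)"
        by (rule suminf_ennreal2[OF _ that]) auto
      then show ?thesis by simp
    qed
    moreover have "summable (\<lambda>i. real i * pmf (p e) i)" if "(\<Sum>i. ennreal (real i * pmf (p e) i)) \<noteq> \<top>"
      by (rule summable_suminf_not_top[OF _ that]) auto
    ultimately show ?thesis unfolding P_def by blast
  qed
  have "(\<lambda>e. \<Sum>i. ennreal (real i * pmf (p e) i)) \<in> borel_measurable E" by measurable
  then have "{e \<in> space E. P e} \<in> sets E" unfolding P_def by measurable
  moreover have "AE w in M. P (\<xi> 0 w)" using assms by eventually_elim (simp add: P)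
  ultimately have "AE w in M. P (\<xi> k w)" for k by (rule AE_env_shift[where P = P])
  then have "AE w in M. \<forall>k. P (\<xi> k w)" by (simp add: AE_all_countable)
  then show ?thesis
    by eventually_elim (simp add: P env_mean_eq_offspring_mean offspring_mean_pos)
qed

section \<open>Markov bound and deterministic estimates\<close>

lemma prob_growth_exceeds:
  "prob {w \<in> space M. 1 \<le> ennreal (exp (- L)) *
      (inverse (of_nat (generation_size N a w)) * (\<Prod>j\<in>{a..<a + n}. inverse (env_mean j w))
      * of_nat (generation_size N (a + n) w))} \<le> exp (- L)" (is "prob {w \<in> space M. 1 \<le> _ * ?U w} \<le> _")
proof -
  have [measurable]: "generation_size N a \<in> measurable (history (a + n)) (count_space UNIV)"
    "generation_size N (a + n) \<in> measurable (history (a + n)) (count_space UNIV)"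
    by (simp_all add: generation_size_measurable)
  have [measurable]: "?U \<in> borel_measurable M"
    by (rule measurable_from_subalg[OF subalgebra_history[of "a + n"]]) measurable
  have "emeasure M {w \<in> space M. 1 \<le> ennreal (exp (- L)) * ?U w}
      \<le> ennreal (exp (- L)) * (\<integral>\<^sup>+w. ?U w * indicator (space M) w \<partial>M)"
    by (rule nn_integral_Markov_inequality) auto
  also have "(\<integral>\<^sup>+w. ?U w * indicator (space M) w \<partial>M) = (\<integral>\<^sup>+w. ?U w \<partial>M)"
    by (intro nn_integral_cong) simp
  also have "ennreal (exp (- L)) * \<dots> \<le> ennreal (exp (- L)) * 1"
    by (intro mult_left_mono nn_integral_growth_ratio_le_1) simp
  finally show ?thesis by (simp add: emeasure_eq_measure)
qed

end

text \<open>Translates the complement of the Markov event into real numbers. Positivity of the means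
  and of \<open>z\<close> makes all inverses finite, and the product of the means is the exponential
  of the sum of their logarithms.\<close>

lemma growth_bound:
  fixes z z' :: nat and m :: "nat \<Rightarrow> real"
  assumes "finite I" "\<And>j. j \<in> I \<Longrightarrow> m j > 0" "z \<ge> 1"
    and less: "\<not> 1 \<le> ennreal (exp (- L)) * (inverse (of_nat z) * (\<Prod>j\<in>I. inverse (ennreal (m j))) * of_nat z')"
  shows "real z' \<le> real z * exp ((\<Sum>j\<in>I. ln (m j)) + L)"
proof -
  have P: "(\<Prod>j\<in>I. m j) = exp (\<Sum>j\<in>I. ln (m j))"
    using assms(1,2) by (simp add: exp_sum)
  have "(\<Prod>j\<in>I. inverse (ennreal (m j))) = ennreal (\<Prod>j\<in>I. inverse (m j))"
    using assms(2) by (subst prod_ennreal[symmetric]) (auto simp: inverse_ennreal less_imp_le intro!: prod.cong)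
  also have "(\<Prod>j\<in>I. inverse (m j)) = exp (- (\<Sum>j\<in>I. ln (m j)))"
    using prod_inversef[of m I] P by (simp add: exp_minus comp_def)
  finally have "ennreal (exp (- L)) * (inverse (of_nat z) * (\<Prod>j\<in>I. inverse (ennreal (m j))) * of_nat z')
      = ennreal (exp (- L) * (inverse (real z) * exp (- (\<Sum>j\<in>I. ln (m j))) * real z'))"
    using assms(3) by (simp add: ennreal_mult inverse_ennreal ennreal_of_nat_eq_real_of_nat)
  with less have "exp (- L) * (inverse (real z) * exp (- (\<Sum>j\<in>I. ln (m j))) * real z') < 1"
    by (simp add: not_le)
  then show ?thesis
    using assms(3) by (simp add: exp_minus exp_add field_simps)
qed

text \<open>Completing the square: the second claim amounts to \<open>(H * L)\<^sup>2 + 2 * n *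
  s\<^sup>2 * L \<le> (t - H * L)\<^sup>2\<close>. It holds because \<open>t - H * L\<close> is at
  least the rescaled square root \<open>r\<close>, whose square dominates the left side.\<close>

lemma bernstein_exponent:
  fixes L H s n :: real
  assumes n: "n > 0" and L: "L > 0" and H: "H > 0"
    and t: "t = n * (6 * (1 + H) / n * L + sqrt (36 * (1 + H)\<^sup>2 / n\<^sup>2 * L\<^sup>2 + 2 / n * s\<^sup>2 * L)) - L"
  shows "t > 0" and "L \<le> t\<^sup>2 / (2 * (n * s\<^sup>2 + H * t))"
proof -
  define r where "r = sqrt (36 * (1 + H)\<^sup>2 * L\<^sup>2 + 2 * n * s\<^sup>2 * L)"
  have "n * sqrt (36 * (1 + H)\<^sup>2 / n\<^sup>2 * L\<^sup>2 + 2 / n * s\<^sup>2 * L)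
      = sqrt (n\<^sup>2 * (36 * (1 + H)\<^sup>2 / n\<^sup>2 * L\<^sup>2 + 2 / n * s\<^sup>2 * L))"
    using n by (simp add: real_sqrt_mult)
  also have "n\<^sup>2 * (36 * (1 + H)\<^sup>2 / n\<^sup>2 * L\<^sup>2 + 2 / n * s\<^sup>2 * L) = 36 * (1 + H)\<^sup>2 * L\<^sup>2 + 2 * n * s\<^sup>2 * L"
    using n by (simp add: field_simps power2_eq_square)
  \<comment> \<open>Subtracting \<open>L\<close> only lowers its coefficient from 6 to 5, so
    \<open>t\<close> still exceeds \<open>H * L + r\<close>.\<close>
  finally have tr: "t = 5 * L + 6 * (H * L) + r"
    using n unfolding t r_def by (simp add: distrib_left) (simp add: field_simps)
  have r0: "r \<ge> 0" unfolding r_def using n L by simp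
  have HL: "H * L > 0" using H L by simp
  show t0: "t > 0" using tr r0 HL L by linarith
  have "r\<^sup>2 = 36 * (1 + H)\<^sup>2 * L\<^sup>2 + 2 * n * s\<^sup>2 * L"
    unfolding r_def using n L by simp
  moreover have "(H * L)\<^sup>2 \<le> 36 * (1 + H)\<^sup>2 * L\<^sup>2"
  proof -
    have "(H * L)\<^sup>2 \<le> (6 * (1 + H) * L)\<^sup>2"
      using H L by (intro power_mono mult_right_mono) auto
    then show ?thesis unfolding power_mult_distrib by simp
  qed
  moreover have "r\<^sup>2 \<le> (t - H * L)\<^sup>2"
    using r0 tr HL L by (intro power_mono) auto
  ultimately have "(H * L)\<^sup>2 + 2 * n * s\<^sup>2 * L \<le> (t - H * L)\<^sup>2" by linarith
  then have "L * (2 * (n * s\<^sup>2 + H * t)) \<le> t\<^sup>2"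
    by (simp add: power2_eq_square algebra_simps)
  moreover have "n * s\<^sup>2 + H * t > 0" using n H t0 by (intro add_nonneg_pos) auto
  ultimately show "L \<le> t\<^sup>2 / (2 * (n * s\<^sup>2 + H * t))" by (simp add: pos_le_divide_eq)
qed

section \<open>Union bound over the two exceptional events\<close>

theorem proposition3p3:
  fixes M :: "'w measure" and E :: "'e measure"
    and \<xi> :: "nat \<Rightarrow> 'w \<Rightarrow> 'e" and p :: "'e \<Rightarrow> nat pmf"
    and N :: "nat \<Rightarrow> nat \<Rightarrow> 'w \<Rightarrow> nat"
    and Z :: "nat \<Rightarrow> 'w \<Rightarrow> nat" and X :: "'w \<Rightarrow> real" and A :: "'w \<Rightarrow> real"
    and \<mu> \<sigma> H \<delta> \<Delta> :: real and n\<^sub>0 n :: nat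
  assumes bpre: "branching_process_random_env M E \<xi> p N"
    and Z_def: "Z = generation_size N"
    and no_extinction: "AE w in M. pmf (p (\<xi> 0 w)) 0 = 0"
    and finite_mean: "AE w in M. summable (\<lambda>i. real i * pmf (p (\<xi> 0 w)) i)"
    and X_def: "X = (\<lambda>w. ln (offspring_mean p \<xi> 0 w))"
    and X_integrable: "integrable M X"
    and mu_def: "\<mu> = (\<integral>w. X w \<partial>M)"
    and finite_variance: "integrable M (\<lambda>w. (X w - \<mu>)\<^sup>2)"
    and sigma_def: "\<sigma>\<^sup>2 = (\<integral>w. (X w - \<mu>)\<^sup>2 \<partial>M)"
    and sigma_pos: "\<sigma> > 0"
    and H_pos: "H > 0"
    and moments_finite: "\<And>k::nat. k \<ge> 3 \<Longrightarrow> integrable M (\<lambda>w. (X w - \<mu>) ^ k)"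
    and bernstein: "\<And>k::nat. k \<ge> 3 \<Longrightarrow>
          (\<integral>w. (X w - \<mu>) ^ k \<partial>M) \<le> 1/2 * fact k * H ^ (k - 2) * (\<integral>w. (X w - \<mu>)\<^sup>2 \<partial>M)"
    and n_pos: "n \<ge> 1"
    and delta: "0 < \<delta>" "\<delta> < 1"
    and Delta_def: "\<Delta> = 6 * (1 + H) / real n * ln (2 / \<delta>)
          + sqrt (36 * (1 + H)\<^sup>2 / (real n)\<^sup>2 * (ln (2 / \<delta>))\<^sup>2
                  + 2 / real n * \<sigma>\<^sup>2 * ln (2 / \<delta>))"
    and A_def: "A = (\<lambda>w. real (Z n\<^sub>0 w) * exp (real n * (\<mu> + \<Delta>)))"
  shows "\<P>(w in M. real (Z (n\<^sub>0 + n) w) \<in> {1..A w}) \<ge> 1 - \<delta>"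
proof -
  interpret branching_process_random_env M E \<xi> p N by (rule bpre)
  define L where "L = ln (2 / \<delta>)"
  have L: "L > 0" using delta by (simp add: L_def)
  have expL: "exp (- L) = \<delta> / 2" using delta by (simp add: L_def exp_minus)
  \<comment> \<open>The deviation left to the environment once the Markov bound has used up a factor
    \<open>exp L\<close>.\<close>
  define t where "t = real n * \<Delta> - L"
  have n: "real n > 0" using n_pos by simp
  note t = bernstein_exponent[OF n L H_pos t_def[unfolded Delta_def, folded L_def]]
  define I where "I = {n\<^sub>0..<n\<^sub>0 + n}"
  \<comment> \<open>The centred log-mean is a measurable function of the environment value, so
    independence and equality of laws pass from \<open>\<xi>\<close> to the summands.\<close>
  define h where "h e = ln (\<Sum>i. real i * pmf (p e) i) - \<mu>" for e
  note [measurable] = offspring_law_measurable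
  have h [measurable]: "h \<in> borel_measurable E" unfolding h_def by measurable
  have hX: "h (\<xi> 0 w) = X w - \<mu>" for w by (simp add: h_def X_def offspring_mean_def)
  have mgf: "(\<integral>\<^sup>+w. ennreal (exp (l * h (\<xi> j w))) \<partial>M) \<le> ennreal (exp (l\<^sup>2 * \<sigma>\<^sup>2 / (2 * (1 - l * H))))"
    if "0 \<le> l" "l * H < 1" for l j
  proof -
    have "(\<integral>\<^sup>+w. ennreal (exp (l * h (\<xi> j w))) \<partial>M) = (\<integral>\<^sup>+w. ennreal (exp (l * h (\<xi> 0 w))) \<partial>M)"
      by (rule nn_integral_env_shift) measurable
    also have "\<dots> \<le> ennreal (exp (l\<^sup>2 * \<sigma>\<^sup>2 / (2 * (1 - l * H))))"
      unfolding hX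
    proof (rule bernstein_mgf_bound)
      fix k :: nat
      consider "k = 0" | "k = 1" | "k = 2" | "k \<ge> 3" by linarith
      then show "integrable M (\<lambda>w. (X w - \<mu>) ^ k)"
        using X_integrable finite_variance moments_finite by cases auto
    qed (use X_integrable mu_def sigma_def bernstein H_pos that in \<open>simp_all add: prob_space\<close>)
    finally show ?thesis .
  qed
  \<comment> \<open>\<open>S1\<close> is the event of unusually large environmental means,
    \<open>S2\<close> that of unusually large growth relative to these means.\<close>
  define S1 where "S1 = {w \<in> space M. (\<Sum>j\<in>I. h (\<xi> j w)) \<ge> t}"
  define S2 where "S2 = {w \<in> space M. 1 \<le> ennreal (exp (- L)) *
      (inverse (of_nat (Z n\<^sub>0 w)) * (\<Prod>j\<in>I. inverse (env_mean j w)) * of_nat (Z (n\<^sub>0 + n) w))}"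
  have [measurable]: "Z k \<in> measurable M (count_space UNIV)" "env_mean k \<in> borel_measurable M" for k
    unfolding Z_def
    by (rule measurable_from_subalg[OF subalgebra_history[of k]]; simp add: generation_size_measurable)+
  have [measurable]: "S1 \<in> events" "S2 \<in> events" unfolding S1_def S2_def by measurable
  have "prob S1 \<le> exp (- (t\<^sup>2 / (2 * (real (card I) * \<sigma>\<^sup>2 + H * t))))"
    unfolding S1_def
  proof (rule bernstein_tail_bound)
    show "indep_vars (\<lambda>_. borel) (\<lambda>j w. h (\<xi> j w)) I"
      using indep_vars_subset[OF env_indep subset_UNIV] by (rule indep_vars_compose2) measurable
  qed (use mgf t sigma_pos H_pos n_pos in \<open>auto simp: I_def\<close>)
  also have "\<dots> \<le> exp (- L)" using t(2) by (simp add: I_def)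
  finally have S1: "prob S1 \<le> \<delta> / 2" using expL by simp
  have S2: "prob S2 \<le> \<delta> / 2"
    using prob_growth_exceeds[of L n\<^sub>0 n] unfolding S2_def Z_def I_def expL .
  have "AE w in M. w \<in> space M - (S1 \<union> S2) \<longrightarrow> w \<in> {w \<in> space M. real (Z (n\<^sub>0 + n) w) \<in> {1..A w}}"
    using AE_generation_size_pos[OF no_extinction] AE_regular_env[OF no_extinction finite_mean]
  proof eventually_elim
    case (elim w)
    show ?case
    proof
      assume w: "w \<in> space M - (S1 \<union> S2)"
      let ?m = "\<lambda>j. offspring_mean p \<xi> j w"
      have "real (Z (n\<^sub>0 + n) w) \<le> real (Z n\<^sub>0 w) * exp ((\<Sum>j\<in>I. ln (?m j)) + L)"
        using w elim by (intro growth_bound) (auto simp: S2_def Z_def I_def)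
      also have "(\<Sum>j\<in>I. ln (?m j)) = (\<Sum>j\<in>I. h (\<xi> j w)) + real n * \<mu>"
        by (simp add: h_def offspring_mean_def sum_subtractf I_def)
      \<comment> \<open>Outside \<open>S1\<close> the centred sum is below
        \<open>real n * \<Delta> - L\<close>, so the additional \<open>L\<close> in the exponent
        cancels.\<close>
      also have "real (Z n\<^sub>0 w) * exp ((\<Sum>j\<in>I. h (\<xi> j w)) + real n * \<mu> + L) \<le> A w"
        using w unfolding A_def S1_def t_def
        by (intro mult_left_mono) (auto simp: algebra_simps)
      finally show "w \<in> {w \<in> space M. real (Z (n\<^sub>0 + n) w) \<in> {1..A w}}"
        using w elim by (simp add: Z_def)
    qed
  qed
  moreover have "{w \<in> space M. real (Z (n\<^sub>0 + n) w) \<in> {1..A w}} \<in> events"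
  proof -
    have [measurable]: "(\<lambda>w. real (Z k w)) \<in> borel_measurable M" for k
      by measurable
    have "{w \<in> space M. 1 \<le> real (Z (n\<^sub>0 + n) w)
        \<and> real (Z (n\<^sub>0 + n) w) \<le> real (Z n\<^sub>0 w) * exp (real n * (\<mu> + \<Delta>))} \<in> events"
      by measurable
    then show ?thesis by (simp only: A_def atLeastAtMost_iff)
  qed
  ultimately have "prob (space M - (S1 \<union> S2)) \<le> \<P>(w in M. real (Z (n\<^sub>0 + n) w) \<in> {1..A w})"
    by (rule finite_measure_mono_AE)
  moreover have "prob (space M - (S1 \<union> S2)) = 1 - prob (S1 \<union> S2)"
    by (rule prob_compl) measurable
  moreover have "prob (S1 \<union> S2) \<le> prob S1 + prob S2"
    by (rule measure_Un_le) auto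
  ultimately show ?thesis using S1 S2 by linarith
qed

end
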